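(* Let $k\ge 1$ and $n\ge 0$ be integers. The $(k+1)$-tuple of statistics $(\mathrm{pk}_0,\mathrm{pk}_1,\dots,\mathrm{pk}_{k-1},\mathrm{dd})$ on the set $\mathcal{P}^k_n$ of $k$-Dyck paths of down-size $n$ is jointly equidistributed with any of its permutations. That is, writing $(s_0,\dots,s_{k})=(\mathrm{pk}_0,\dots,\mathrm{pk}_{k-1},\mathrm{dd})$, for every permutation $\sigma$ of $\{0,1,\dots,k\}$ and all nonnegative integers $r_0,\dots,r_k$, the number of $P\in\mathcal{P}^k_n$ with $s_i(P)=r_i$ for all $i$ equals the number of $P\in\mathcal{P}^k_n$ with $s_{\sigma(i)}(P)=r_i$ for all $i$.
   Context: A $k$-Dyck path of down-size $n$ is a lattice path from $(0,0)$ to $((k+1)n,0)$ with steps $u=(1,1)$ (up-step) and $d=(1,-k)$ (down-step) that stays in the first quadrant (i.e. never goes below the $x$-axis). It has $n$ down-steps and $kn$ up-steps; for $n=0$ it is the one-point (empty) path. $\mathcal{P}^k_n$ is the set of all such paths. A peak is a block of two consecutive steps $ud$; its height is the second coordinate of the left endpoint of its $d$ step. A double descent is a block of two consecutive steps $dd$. For $0\le i\le k-1$, $\mathrm{pk}_i(P)$ is the number of non-rightmost peaks of $P$ (all peaks except the last one in the path) whose height is congruent to $i$ modulo $k$; $\mathrm{dd}(P)$ is the number of double descents of $P$. All statistics are $0$ on the empty path. *)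

theory Defs
  imports "HOL-Number_Theory.Cong" "HOL-Combinatorics.Permutations"
begin

datatype step = U | D

text \<open>
  A path from the origin is the list of its steps. Every step advances the first coordinate
  by one, so the path has reached the point \<open>(length w, height k w)\<close> after the steps \<open>w\<close>.
\<close>

fun step_height :: "nat \<Rightarrow> step \<Rightarrow> int" where
  "step_height k U = 1"
| "step_height k D = - int k"

definition height :: "nat \<Rightarrow> step list \<Rightarrow> int" where
  "height k w = (\<Sum>s\<leftarrow>w. step_height k s)"

definition dyck_paths :: "nat \<Rightarrow> nat \<Rightarrow> step list set" where
  "dyck_paths k n =
     {w. length w = (k + 1) * n \<and> height k w = 0 \<and>
         (\<forall>j \<le> length w. height k (take j w) \<ge> 0)}"

text \<open>A block of two consecutive steps is identified by the index of its first step.\<close>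

definition peaks :: "step list \<Rightarrow> nat set" where
  "peaks w = {j. Suc j < length w \<and> w ! j = U \<and> w ! Suc j = D}"

definition double_descents :: "step list \<Rightarrow> nat set" where
  "double_descents w = {j. Suc j < length w \<and> w ! j = D \<and> w ! Suc j = D}"

text \<open>The left endpoint of the \<open>D\<close> step of the peak \<open>j\<close> is reached after \<open>Suc j\<close> steps.\<close>

definition peak_height :: "nat \<Rightarrow> step list \<Rightarrow> nat \<Rightarrow> int" where
  "peak_height k w j = height k (take (Suc j) w)"

definition pk :: "nat \<Rightarrow> nat \<Rightarrow> step list \<Rightarrow> nat" where
  "pk k i w =
     card {j \<in> peaks w. (\<exists>j' \<in> peaks w. j < j') \<and> [peak_height k w j = int i] (mod int k)}"

definition dd :: "step list \<Rightarrow> nat" where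
  "dd w = card (double_descents w)"

text \<open>The tuple \<open>(pk\<^sub>0, \<dots>, pk\<^sub>k\<^sub>-\<^sub>1, dd)\<close>, indexed by \<open>{0, \<dots>, k}\<close>.\<close>

definition stat :: "nat \<Rightarrow> nat \<Rightarrow> step list \<Rightarrow> nat" where
  "stat k i w = (if i < k then pk k i w else dd w)"

lemma finite_dyck_paths: "finite (dyck_paths k n)"
proof -
  have "(UNIV :: step set) = {U, D}"
    using step.exhaust by blast
  then have "finite (UNIV :: step set)"
    by (metis finite.emptyI finite.insertI)
  then have "finite {w :: step list. set w \<subseteq> UNIV \<and> length w = (k + 1) * n}"
    by (rule finite_lists_length_eq)
  then show ?thesis
    by (rule finite_subset[rotated]) (auto simp: dyck_paths_def)
qed

end

theory Submission
  imports Defs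
begin

text \<open>
  The idea is to encode \<open>k\<close>-Dyck paths of down-size \<open>n\<close> as trees with \<open>n\<close> nodes, each of which has
  \<open>k + 1\<close> ordered, possibly empty subtrees in positions \<open>0, \<dots>, k\<close>, in such a way that the statistic
  number \<open>c\<close> of the path is the number of edges of type \<open>c\<close> of the tree, that is, of nonempty
  subtrees in position \<open>c\<close>. Permuting the positions at every node of a tree then permutes the
  statistics, and this proves the theorem.

  The encoding rests on the decomposition \<open>P = P\<^sub>0 U P\<^sub>1 U \<dots> U P\<^sub>k D\<close> of a nonempty path, where \<open>P\<^sub>i\<close> is
  a path at level \<open>i\<close>. It is carried out by reading the steps from left to right with
  a stack of trees: \<open>U\<close> pushes an empty tree, and \<open>D\<close> replaces the topmost \<open>k + 1\<close> trees by one new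
  node. After a prefix of height \<open>h\<close> the stack has the levels \<open>0, \<dots>, h\<close>. The final \<open>D\<close> of \<open>P\<close> is the
  second step of a double descent iff \<open>P\<^sub>k\<close> is nonempty, so \<open>P\<^sub>k\<close> goes to position \<open>k\<close>. For \<open>i < k\<close>
  the subpath \<open>P\<^sub>i\<close> goes to the position \<open>c < k\<close> congruent to its absolute level modulo \<open>k\<close>.

  The reason why this choice of positions gives the right statistics is that the last peak of
  a nonempty path has a height divisible by \<open>k\<close>: only down-steps follow it, and these do not change
  the height modulo \<open>k\<close>. Hence the last peak of a nonempty subpath at level \<open>l\<close> has a height congruent to
  \<open>l\<close>. For the subpaths \<open>P\<^sub>i\<close> with \<open>i < k\<close> this peak is charged to the edge leading to \<open>P\<^sub>i\<close>, whereas the last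
  peak of a nonempty \<open>P\<^sub>k\<close> is also the last peak of \<open>P\<close>. The lemma \<open>parses_residue_peaks\<close> is the
  precise form of this count for prefixes.
\<close>

section \<open>Trees with ordered positions\<close>

text \<open>\<open>Leaf\<close> is the empty tree; a node carries the list of its subtrees in the positions \<open>0, 1, \<dots>\<close>.\<close>

datatype tree = Leaf | Node "tree list"

text \<open>Every node has exactly \<open>m\<close> positions.\<close>

fun full :: "nat \<Rightarrow> tree \<Rightarrow> bool" where
  "full m Leaf = True"
| "full m (Node ts) = (length ts = m \<and> (\<forall>t\<in>set ts. full m t))"

fun nodes :: "tree \<Rightarrow> nat" where
  "nodes Leaf = 0"
| "nodes (Node ts) = Suc (\<Sum>t\<leftarrow>ts. nodes t)"

text \<open>The number of edges of type \<open>c\<close>, that is, of nonempty subtrees in position \<open>c\<close> of their parent.\<close>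

fun edges :: "nat \<Rightarrow> tree \<Rightarrow> nat" where
  "edges c Leaf = 0"
| "edges c (Node ts) = of_bool (ts ! c \<noteq> Leaf) + (\<Sum>t\<leftarrow>ts. edges c t)"

text \<open>
  Permutation of the positions at every node: position \<open>i\<close> receives the subtree from position \<open>\<sigma> i\<close>.
\<close>

fun relabel :: "(nat \<Rightarrow> nat) \<Rightarrow> tree \<Rightarrow> tree" where
  "relabel \<sigma> Leaf = Leaf"
| "relabel \<sigma> (Node ts) = Node (permute_list \<sigma> (map (relabel \<sigma>) ts))"

lemma relabel_eq_Leaf_iff [simp]: "relabel \<sigma> t = Leaf \<longleftrightarrow> t = Leaf"
  by (cases t) auto

lemma sum_list_permute_list:
  fixes f :: "'a \<Rightarrow> nat"
  assumes "\<sigma> permutes {..<length xs}"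
  shows "(\<Sum>x\<leftarrow>permute_list \<sigma> xs. f x) = (\<Sum>x\<leftarrow>xs. f x)"
  using assms by (metis mset_map mset_permute_list sum_mset_sum_list)

lemma full_relabel:
  assumes "\<sigma> permutes {..<m}" "full m t"
  shows "full m (relabel \<sigma> t)"
  using assms(2) by (induction t) (auto simp: assms(1))

lemma nodes_relabel:
  assumes "\<sigma> permutes {..<m}" "full m t"
  shows "nodes (relabel \<sigma> t) = nodes t"
  using assms(2)
proof (induction t)
  case (Node ts)
  have "(\<Sum>t\<leftarrow>ts. nodes (relabel \<sigma> t)) = (\<Sum>t\<leftarrow>ts. nodes t)"
    using Node by (intro arg_cong[of _ _ sum_list] map_cong) auto
  with Node.prems assms(1) show ?case
    by (simp add: sum_list_permute_list o_def)
qed simp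

lemma edges_relabel:
  assumes "\<sigma> permutes {..<m}" "full m t" "c < m"
  shows "edges c (relabel \<sigma> t) = edges (\<sigma> c) t"
  using assms(2)
proof (induction t)
  case (Node ts)
  have "(\<Sum>t\<leftarrow>ts. edges c (relabel \<sigma> t)) = (\<Sum>t\<leftarrow>ts. edges (\<sigma> c) t)"
    using Node by (intro arg_cong[of _ _ sum_list] map_cong) auto
  moreover have "\<sigma> c < m"
    using assms permutes_in_image[of \<sigma> "{..<m}" c] by simp
  ultimately show ?case
    using Node.prems assms(1,3) by (simp add: sum_list_permute_list o_def permute_list_nth)
qed simp

lemma relabel_relabel_inverse:
  assumes "\<sigma> permutes {..<m}" "\<tau> permutes {..<m}" "\<sigma> \<circ> \<tau> = id" "full m t"
  shows "relabel \<tau> (relabel \<sigma> t) = t"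
  using assms(4)
proof (induction t)
  case (Node ts)
  have "map (relabel \<tau>) (map (relabel \<sigma>) ts) = ts"
    using Node by (auto intro!: map_idI)
  moreover have "relabel \<tau> (relabel \<sigma> (Node ts))
      = Node (permute_list \<tau> (permute_list \<sigma> (map (relabel \<tau>) (map (relabel \<sigma>) ts))))"
    using Node.prems assms(1) by (simp add: permute_list_map)
  ultimately show ?case
    using Node.prems assms by (simp flip: permute_list_compose)
qed simp

section \<open>Reading a path with a stack of trees\<close>

text \<open>
  \<open>parses k w S\<close> means that reading the path \<open>w\<close> leaves the stack \<open>S\<close>, whose bottom, at level \<open>0\<close>, is the
  head of the list. In a down-step to level \<open>l = length S\<close> the trees \<open>ts\<close> have the levels
  \<open>l, \<dots>, l + k - 1\<close>, and the rotation, which shifts by \<open>- l\<close> modulo \<open>k\<close>, puts the tree of level \<open>j\<close>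
  in position \<open>j mod k\<close>.
\<close>

inductive parses :: "nat \<Rightarrow> step list \<Rightarrow> tree list \<Rightarrow> bool" for k where
  start: "parses k [] [Leaf]"
| up: "parses k w S \<Longrightarrow> parses k (w @ [U]) (S @ [Leaf])"
| down: "parses k w (S @ ts @ [t]) \<Longrightarrow> length ts = k
         \<Longrightarrow> parses k (w @ [D]) (S @ [Node (rotate ((k - 1) * length S) ts @ [t])])"

lemma parses_nonempty: "parses k w S \<Longrightarrow> S \<noteq> []"
  by (induction rule: parses.induct) auto

lemma parses_last_Leaf_iff: "parses k w S \<Longrightarrow> last S = Leaf \<longleftrightarrow> w = [] \<or> last w = U"
  by (induction rule: parses.induct) auto

lemma parses_full: "parses k w S \<Longrightarrow> t \<in> set S \<Longrightarrow> full (Suc k) t"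
  by (induction arbitrary: t rule: parses.induct) auto

lemma sum_list_rotate: "(\<Sum>x\<leftarrow>rotate m xs. f x) = (\<Sum>x\<leftarrow>xs. f x :: nat)"
proof -
  have "(\<Sum>x\<leftarrow>drop n xs @ take n xs. f x) = (\<Sum>x\<leftarrow>take n xs @ drop n xs. f x)" for n
    by (simp only: map_append sum_list_append add.commute)
  then show ?thesis by (simp add: rotate_drop_take)
qed

lemma bij_rotate: "bij (rotate m)"
  unfolding rotate_def by (rule bij_fn[OF bij_rotate1])

lemma parses_length:
  "parses k w S \<Longrightarrow> Suc (length w) = (k + 1) * (\<Sum>t\<leftarrow>S. nodes t) + length S"
  by (induction rule: parses.induct) (auto simp: sum_list_rotate algebra_simps)

lemma height_snoc [simp]: "height k (w @ [s]) = height k w + step_height k s"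
  by (simp add: height_def)

lemma parses_height: "parses k w S \<Longrightarrow> height k w = int (length S) - 1"
  by (induction rule: parses.induct) (auto simp: height_def)

lemma parses_prefix_nonneg:
  "parses k w S \<Longrightarrow> j \<le> length w \<Longrightarrow> height k (take j w) \<ge> 0"
proof (induction arbitrary: j rule: parses.induct)
  case start
  then show ?case by (simp add: height_def)
next
  case (up w S)
  then show ?case
    using parses_height[OF parses.up[OF up.hyps]]
    by (cases "j \<le> length w") (auto simp: not_le)
next
  case (down w S ts t)
  then show ?case
    using parses_height[OF parses.down[OF down.hyps]]
    by (cases "j \<le> length w") (auto simp: not_le)
qed

lemma parses_stack_unique: "parses k w S \<Longrightarrow> parses k w S' \<Longrightarrow> S = S'"
proof (induction arbitrary: S' rule: parses.induct)
  case start
  then show ?case by (auto elim: parses.cases)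
next
  case (up w S)
  from up.prems show ?case
    by cases (use up.IH in auto)
next
  case (down w S ts t)
  from down.prems show ?case
  proof cases
    case (down S'' ts' t')
    with down.IH[of "S'' @ ts' @ [t']"] have "S @ ts @ [t] = S'' @ ts' @ [t']"
      by simp
    with down \<open>length ts = k\<close> show ?thesis by simp
  qed auto
qed

lemma parses_path_unique: "parses k w S \<Longrightarrow> parses k w' S \<Longrightarrow> w = w'"
proof (induction arbitrary: w' rule: parses.induct)
  case start
  then show ?case by cases (auto dest: parses_nonempty)
next
  case (up w S)
  from up.prems show ?case
    by cases (use up.IH parses_nonempty[OF up.hyps] in auto)
next
  case (down w S ts t)
  from down.prems show ?case
  proof cases
    case (down w'' S'' ts' t')
    then have "S'' = S" "t' = t" "ts' = ts"
      by (auto dest!: injD[OF bij_is_inj[OF bij_rotate]])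
    with down down.IH[of w''] show ?thesis by simp
  qed auto
qed

lemma path_parses_exists:
  assumes "\<And>j. j \<le> length w \<Longrightarrow> height k (take j w) \<ge> 0"
  shows "\<exists>S. parses k w S"
  using assms
proof (induction w rule: rev_induct)
  case Nil
  show ?case using parses.start by blast
next
  case (snoc s w)
  have "height k (take j w) \<ge> 0" if "j \<le> length w" for j
    using snoc.prems[of j] that by simp
  with snoc.IH obtain S where S: "parses k w S" by blast
  show ?case
  proof (cases s)
    case U
    with S show ?thesis using parses.up by blast
  next
    case D
    have "int (length S) - 1 - int k \<ge> 0"
      using snoc.prems[of "Suc (length w)"] parses_height[OF S] D by simp
    then have len: "Suc k \<le> length S" by linarith
    define l where "l = length S - Suc k"
    define ts where "ts = butlast (drop l S)"
    have "drop l S \<noteq> []" "length ts = k"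
      using len by (auto simp: l_def ts_def)
    then have "S = take l S @ ts @ [last (drop l S)]"
      unfolding ts_def by (metis append_butlast_last_id append_take_drop_id)
    with S \<open>length ts = k\<close> D show ?thesis using parses.down by metis
  qed
qed

lemma stack_parses_exists:
  assumes "S \<noteq> []" "\<forall>t\<in>set S. full (Suc k) t"
  shows "\<exists>w. parses k w S"
  using assms
proof (induction "(k + 1) * (\<Sum>t\<leftarrow>S. nodes t) + length S" arbitrary: S rule: less_induct)
  case less
  obtain S' t where S: "S = S' @ [t]"
    using less.prems by (metis rev_exhaust)
  show ?case
  proof (cases t)
    case Leaf
    show ?thesis
    proof (cases "S' = []")
      case True
      then show ?thesis using S Leaf parses.start by auto
    next
      case False
      then have "\<exists>w. parses k w S'"
        using less.prems S Leaf by (intro less.hyps) auto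
      then show ?thesis using S Leaf parses.up by blast
    qed
  next
    case (Node us)
    then have us: "length us = Suc k" "\<forall>t\<in>set us. full (Suc k) t"
      using less.prems S by auto
    obtain vs u where vs: "us = vs @ [u]" "length vs = k"
      using us by (metis length_Suc_conv_rev)
    obtain ts where ts: "rotate ((k - 1) * length S') ts = vs"
      using bij_is_surj[OF bij_rotate] by (metis surjD)
    then have "length ts = k" "set ts = set vs"
      using vs by auto
    moreover have "(\<Sum>t\<leftarrow>ts. nodes t) = (\<Sum>t\<leftarrow>vs. nodes t)"
      using ts sum_list_rotate by metis
    ultimately have "\<exists>w. parses k w (S' @ ts @ [u])"
      using less.prems us vs S Node by (intro less.hyps) auto
    then show ?thesis
      using S Node vs ts \<open>length ts = k\<close> parses.down by metis
  qed
qed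

section \<open>The statistics along the reading\<close>

lemma finite_peaks [simp]: "finite (peaks w)"
  by (rule finite_subset[of _ "{..<length w}"]) (auto simp: peaks_def)

lemma peaks_Nil [simp]: "peaks [] = {}"
  by (simp add: peaks_def)

lemma peaks_snoc_U [simp]: "peaks (w @ [U]) = peaks w"
  by (auto simp: peaks_def nth_append)

lemma peaks_snoc_D:
  "peaks (w @ [D]) = (if w \<noteq> [] \<and> last w = U then insert (length w - 1) (peaks w) else peaks w)"
  by (cases w rule: rev_cases) (auto simp: peaks_def nth_append less_Suc_eq)

lemma finite_double_descents [simp]: "finite (double_descents w)"
  by (rule finite_subset[of _ "{..<length w}"]) (auto simp: double_descents_def)

lemma double_descents_snoc_U: "double_descents (w @ [U]) = double_descents w"
  by (auto simp: double_descents_def nth_append)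

lemma double_descents_snoc_D:
  "double_descents (w @ [D]) =
     (if w \<noteq> [] \<and> last w = D then insert (length w - 1) (double_descents w) else double_descents w)"
  by (cases w rule: rev_cases) (auto simp: double_descents_def nth_append less_Suc_eq)

lemma parses_dd: "parses k w S \<Longrightarrow> dd w = (\<Sum>t\<leftarrow>S. edges k t)"
proof (induction rule: parses.induct)
  case start
  then show ?case by (simp add: dd_def double_descents_def)
next
  case (up w S)
  then show ?case by (simp add: dd_def double_descents_snoc_U)
next
  case (down w S ts t)
  have "length w - 1 \<notin> double_descents w"
    by (auto simp: double_descents_def)
  then have "dd (w @ [D]) = dd w + of_bool (w \<noteq> [] \<and> last w = D)"
    by (simp add: dd_def double_descents_snoc_D)
  moreover have "w \<noteq> [] \<and> last w = D \<longleftrightarrow> t \<noteq> Leaf"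
    using parses_last_Leaf_iff[OF down.hyps(1)] by (cases "last w") auto
  ultimately show ?case
    using down.IH down.hyps(2) by (simp add: nth_append sum_list_rotate)
qed

text \<open>The peaks, the last one included, of height congruent to \<open>c\<close> modulo \<open>k\<close>.\<close>

definition residue_peaks :: "nat \<Rightarrow> nat \<Rightarrow> step list \<Rightarrow> nat set" where
  "residue_peaks k c w = {j \<in> peaks w. [peak_height k w j = int c] (mod int k)}"

lemma finite_residue_peaks [simp]: "finite (residue_peaks k c w)"
  by (simp add: residue_peaks_def)

lemma peak_height_snoc: "j < length w \<Longrightarrow> peak_height k (w @ [s]) j = peak_height k w j"
  by (simp add: peak_height_def)

lemma peaks_less_length: "j \<in> peaks w \<Longrightarrow> Suc j < length w"
  by (simp add: peaks_def)

lemma residue_peaks_snoc_U: "residue_peaks k c (w @ [U]) = residue_peaks k c w"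
  by (auto simp: residue_peaks_def peak_height_snoc dest: peaks_less_length)

lemma card_residue_peaks_snoc_D:
  "card (residue_peaks k c (w @ [D])) = card (residue_peaks k c w)
     + of_bool (w \<noteq> [] \<and> last w = U \<and> [height k w = int c] (mod int k))"
proof -
  have "peak_height k (w @ [D]) (length w - 1) = height k w" if "w \<noteq> []"
    using that by (simp add: peak_height_def)
  then have "residue_peaks k c (w @ [D]) =
      (if w \<noteq> [] \<and> last w = U \<and> [height k w = int c] (mod int k)
       then insert (length w - 1) (residue_peaks k c w) else residue_peaks k c w)"
    by (auto simp: residue_peaks_def peaks_snoc_D peak_height_snoc dest: peaks_less_length)
  moreover have "length w - 1 \<notin> residue_peaks k c w"
    by (auto simp: residue_peaks_def dest: peaks_less_length)
  ultimately show ?thesis by simp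
qed

text \<open>
  The number of nonempty trees at levels congruent to \<open>c\<close> modulo \<open>k\<close> in a segment of the stack that
  starts at level \<open>l\<close>.
\<close>

definition occupied :: "nat \<Rightarrow> nat \<Rightarrow> nat \<Rightarrow> tree list \<Rightarrow> nat" where
  "occupied k c l S = length (filter (\<lambda>(i, t). t \<noteq> Leaf \<and> i mod k = c) (enumerate l S))"

lemma occupied_append:
  "occupied k c l (S @ T) = occupied k c l S + occupied k c (l + length S) T"
  by (simp add: occupied_def enumerate_append_eq)

lemma occupied_singleton: "occupied k c l [t] = of_bool (t \<noteq> Leaf \<and> l mod k = c)"
  by (simp add: occupied_def)

text \<open>
  Among \<open>k\<close> consecutive levels exactly one is congruent to \<open>c\<close>, and its tree is the one that
  the rotation puts in position \<open>c\<close>.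
\<close>

lemma occupied_block:
  assumes "length ts = k" "c < k"
  shows "occupied k c l ts = of_bool (rotate ((k - 1) * l) ts ! c \<noteq> Leaf)"
proof -
  define i0 where "i0 = ((k - 1) * l + c) mod k"
  have i0: "(l + i) mod k = c \<longleftrightarrow> i = i0" if "i < k" for i
  proof
    assume "(l + i) mod k = c"
    moreover have "(k - 1) * l + (l + i) = k * l + i"
      using assms(2) by (cases k) auto
    ultimately have "i0 = (k * l + i) mod k"
      unfolding i0_def by (metis mod_add_right_eq)
    with that show "i = i0" by simp
  next
    assume "i = i0"
    then have "(l + i) mod k = (l + ((k - 1) * l + c)) mod k"
      by (simp add: i0_def mod_add_right_eq)
    also have "l + ((k - 1) * l + c) = k * l + c"
      using assms(2) by (cases k) auto
    finally show "(l + i) mod k = c" using assms(2) by simp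
  qed
  have "i0 < k" using assms(2) by (simp add: i0_def)
  have "occupied k c l ts = card {i. i < k \<and> ts ! i \<noteq> Leaf \<and> (l + i) mod k = c}"
    using assms(1)
    by (auto simp: occupied_def length_filter_conv_card nth_enumerate_eq intro!: arg_cong[of _ _ card])
  also have "{i. i < k \<and> ts ! i \<noteq> Leaf \<and> (l + i) mod k = c} = (if ts ! i0 \<noteq> Leaf then {i0} else {})"
    using i0 \<open>i0 < k\<close> by auto
  finally show ?thesis
    using assms by (simp add: nth_rotate i0_def add.commute)
qed

text \<open>
  The peaks of residue \<open>c\<close> correspond to the edges of type \<open>c\<close> inside the trees on the stack together
  with the nonempty trees at levels of residue \<open>c\<close>. In a down-step the nonempty trees among the
  \<open>k\<close> ones below the topmost tree turn into edges whose type is the residue of their level. The level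
  of the new node is congruent to that of the topmost tree, so the node takes over the contribution
  of that tree if it is nonempty; otherwise the down-step completes a peak, whose height is congruent
  to that level.
\<close>

lemma parses_residue_peaks:
  assumes "parses k w S" "c < k"
  shows "card (residue_peaks k c w) = (\<Sum>t\<leftarrow>S. edges c t) + occupied k c 0 S"
  using assms(1)
proof (induction rule: parses.induct)
  case start
  then show ?case by (simp add: residue_peaks_def occupied_singleton)
next
  case (up w S)
  then show ?case by (simp add: residue_peaks_snoc_U occupied_append occupied_singleton)
next
  case (down w S ts t)
  let ?rs = "rotate ((k - 1) * length S) ts"
  have "height k w = int (length S + k)"
    using parses_height[OF down.hyps(1)] down.hyps(2) by simp
  then have "[height k w = int c] (mod int k) \<longleftrightarrow> [length S + k = c] (mod k)"
    by (simp only: cong_int_iff)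
  also have "\<dots> \<longleftrightarrow> length S mod k = c"
    using assms(2) by (simp add: cong_def)
  finally have new: "card (residue_peaks k c (w @ [D])) = card (residue_peaks k c w)
      + of_bool (t = Leaf \<and> length S mod k = c)"
    using parses_last_Leaf_iff[OF down.hyps(1)] parses_nonempty[OF down.hyps(1)]
      \<open>height k w = int (length S + k)\<close> assms(2)
    by (cases "w = []") (auto simp: card_residue_peaks_snoc_D height_def)
  have "occupied k c 0 (S @ ts @ [t]) = occupied k c 0 S + of_bool (?rs ! c \<noteq> Leaf)
      + of_bool (t \<noteq> Leaf \<and> length S mod k = c)"
    using down.hyps(2) assms(2)
    by (simp add: occupied_append occupied_singleton occupied_block)
  moreover have "edges c (Node (?rs @ [t])) = of_bool (?rs ! c \<noteq> Leaf)
      + (\<Sum>t\<leftarrow>ts. edges c t) + edges c t"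
    using down.hyps(2) assms(2) by (simp add: nth_append sum_list_rotate)
  moreover have "occupied k c 0 (S @ [Node (?rs @ [t])])
      = occupied k c 0 S + of_bool (length S mod k = c)"
    by (simp add: occupied_append occupied_singleton)
  ultimately show ?case
    using new down.IH by (auto simp del: edges.simps)
qed

lemma last_peak_height_cong:
  assumes "last w = D" "j \<in> peaks w" "\<forall>j'\<in>peaks w. j' \<le> j"
  shows "[peak_height k w j = height k w] (mod int k)"
  using assms
proof (induction w rule: rev_induct)
  case (snoc s w)
  then have [simp]: "s = D" by simp
  show ?case
  proof (cases "w \<noteq> [] \<and> last w = U")
    case True
    then have "j = length w - 1"
      using snoc.prems peaks_less_length[of j w]
      by (auto simp: peaks_snoc_D)
    then have "peak_height k (w @ [s]) j = height k w"
      using True by (simp add: peak_height_def)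
    then show ?thesis by (simp add: cong_iff_dvd_diff)
  next
    case False
    then have eq: "peaks (w @ [s]) = peaks w" by (auto simp: peaks_snoc_D)
    with snoc.prems have j: "j \<in> peaks w" "\<forall>j'\<in>peaks w. j' \<le> j" by simp_all
    then have "w \<noteq> []" by auto
    with False have "last w = D" by (cases "last w") auto
    with snoc.IH j have "[peak_height k w j = height k w] (mod int k)" by blast
    moreover have "[height k w = height k (w @ [s])] (mod int k)"
      by (simp add: cong_iff_dvd_diff)
    ultimately show ?thesis
      using j(1) peaks_less_length[of j w] by (simp add: peak_height_snoc) (metis cong_trans)
  qed
qed simp

lemma parses_pk:
  assumes "parses k w [t]" "c < k"
  shows "pk k c w = edges c t"
proof (cases "t = Leaf")
  case True
  then have "w = []"
    using parses_length[OF assms(1)] by simp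
  with True show ?thesis by (simp add: pk_def)
next
  case False
  have "0 < k" using assms(2) by simp
  have card: "card (residue_peaks k c' w) = edges c' t + of_bool (c' = 0)" if "c' < k" for c'
    using parses_residue_peaks[OF assms(1) that] False that by (auto simp: occupied_singleton)
  have "card (residue_peaks k 0 w) \<noteq> 0" using card[OF \<open>0 < k\<close>] by simp
  then have ne: "peaks w \<noteq> {}" by (auto simp: residue_peaks_def)
  define M where "M = Max (peaks w)"
  have M: "M \<in> peaks w" "\<forall>j\<in>peaks w. j \<le> M"
    using ne by (auto simp: M_def)
  have "last w = D"
    using parses_last_Leaf_iff[OF assms(1)] False by (cases "last w") auto
  then have "[peak_height k w M = 0] (mod int k)"
    using last_peak_height_cong[OF _ M, of k] parses_height[OF assms(1)] by simp
  then have "[peak_height k w M = int c] (mod int k) \<longleftrightarrow> [0 = int c] (mod int k)"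
    by (metis cong_trans cong_sym)
  also have "\<dots> \<longleftrightarrow> c = 0"
    using assms(2) by (auto simp: cong_def)
  finally have M_res: "M \<in> residue_peaks k c w \<longleftrightarrow> c = 0"
    using M by (simp add: residue_peaks_def)
  have "{j \<in> peaks w. (\<exists>j'\<in>peaks w. j < j') \<and> [peak_height k w j = int c] (mod int k)}
      = residue_peaks k c w - {M}"
    using M by (auto simp: residue_peaks_def not_less order.strict_iff_order)
  then show ?thesis
    using card[OF assms(2)] M_res by (cases "c = 0") (simp_all add: pk_def card_Diff_singleton_if)
qed

lemma parses_stat:
  assumes "parses k w [t]" "c \<le> k"
  shows "stat k c w = edges c t"
  using assms parses_pk[OF assms(1)] parses_dd[OF assms(1)] by (auto simp: stat_def)

section \<open>Equidistribution\<close>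

lemma parses_singleton_in_dyck_paths:
  assumes "parses k w [t]"
  shows "w \<in> dyck_paths k (nodes t)"
  using parses_length[OF assms] parses_height[OF assms] parses_prefix_nonneg[OF assms]
  by (simp add: dyck_paths_def)

lemma dyck_path_parses:
  assumes "w \<in> dyck_paths k n"
  obtains t where "parses k w [t]" "full (Suc k) t" "nodes t = n"
proof -
  obtain S where S: "parses k w S"
    using assms path_parses_exists[of w k] by (auto simp: dyck_paths_def)
  have "length S = 1"
    using parses_height[OF S] assms by (simp add: dyck_paths_def)
  then obtain t where t: "S = [t]"
    by (auto simp: length_Suc_conv)
  moreover have "nodes t = n"
  proof -
    have "(k + 1) * nodes t = (k + 1) * n"
      using parses_length[OF S] assms t by (simp add: dyck_paths_def)
    then show ?thesis by (simp only: mult_cancel1) simp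
  qed
  ultimately show ?thesis
    using that S parses_full[OF S, of t] by simp
qed

text \<open>
  The paths correspond to the trees \<open>t\<close> for which \<open>[t]\<close> is the final stack. The reindexing \<open>\<tau>\<close> need
  not be a permutation.
\<close>

lemma card_dyck_paths_eq_card_trees:
  assumes "\<And>i. i \<le> k \<Longrightarrow> \<tau> i \<le> k"
  shows "card {P \<in> dyck_paths k n. \<forall>i\<in>{0..k}. stat k (\<tau> i) P = r i}
       = card {t. full (Suc k) t \<and> nodes t = n \<and> (\<forall>i\<le>k. edges (\<tau> i) t = r i)}"
    (is "card ?A = card ?B")
proof -
  have "\<forall>t\<in>?B. \<exists>w. parses k w [t]"
    using stack_parses_exists[of "[_]" k] by simp
  then obtain f where "\<forall>t\<in>?B. parses k (f t) [t]"
    by (rule bchoice[THEN exE])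
  then have f: "parses k (f t) [t]" if "t \<in> ?B" for t
    using that by blast
  have "inj_on f ?B"
  proof (rule inj_onI)
    fix t u assume "t \<in> ?B" "u \<in> ?B" "f t = f u"
    then have "parses k (f t) [t]" "parses k (f t) [u]"
      using f[of t] f[of u] by simp_all
    then show "t = u"
      using parses_stack_unique by blast
  qed
  moreover have "f ` ?B = ?A"
  proof (intro equalityI subsetI)
    fix P assume "P \<in> f ` ?B"
    then obtain t where t: "t \<in> ?B" "P = f t" by blast
    then have P: "parses k P [t]" using f by simp
    have "P \<in> dyck_paths k n"
      using parses_singleton_in_dyck_paths[OF P] t(1) by simp
    moreover have "\<forall>i\<in>{0..k}. stat k (\<tau> i) P = r i"
      using parses_stat[OF P] assms t(1) by simp
    ultimately show "P \<in> ?A" by simp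
  next
    fix P assume P: "P \<in> ?A"
    then obtain t where t: "parses k P [t]" "full (Suc k) t" "nodes t = n"
      using dyck_path_parses by blast
    moreover have "\<forall>i\<le>k. edges (\<tau> i) t = r i"
      using parses_stat[OF t(1)] assms P by simp
    ultimately have "t \<in> ?B" by simp
    then have "P = f t"
      using f t(1) parses_path_unique by blast
    with \<open>t \<in> ?B\<close> show "P \<in> f ` ?B" by blast
  qed
  ultimately show ?thesis
    using card_image[of f ?B] by simp
qed

theorem theorem2p1:
  fixes k n :: nat and \<sigma> :: "nat \<Rightarrow> nat" and r :: "nat \<Rightarrow> nat"
  assumes "k \<ge> 1"
    and "\<sigma> permutes {0..k}"
  shows "card {P \<in> dyck_paths k n. \<forall>i\<in>{0..k}. stat k i P = r i}
       = card {P \<in> dyck_paths k n. \<forall>i\<in>{0..k}. stat k (\<sigma> i) P = r i}"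
proof -
  let ?T = "\<lambda>\<tau>. {t. full (Suc k) t \<and> nodes t = n \<and> (\<forall>i\<le>k. edges (\<tau> i) t = r i)}"
  have \<sigma>: "\<sigma> permutes {..<Suc k}"
    using assms(2) by (simp add: atLeast0AtMost lessThan_Suc_atMost)
  then have inv: "inv \<sigma> permutes {..<Suc k}"
    by (rule permutes_inv)
  have \<sigma>_le: "\<sigma> i \<le> k" if "i \<le> k" for i
    using permutes_in_image[OF assms(2), of i] that by simp
  have inv_le: "inv \<sigma> i \<le> k" if "i \<le> k" for i
    using permutes_in_image[OF inv, of i] that by simp
  have "bij_betw (relabel \<sigma>) (?T \<sigma>) (?T (\<lambda>i. i))"
  proof (rule bij_betw_byWitness[where f' = "relabel (inv \<sigma>)"])
    show "\<forall>t\<in>?T \<sigma>. relabel (inv \<sigma>) (relabel \<sigma> t) = t"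
      using relabel_relabel_inverse[OF \<sigma> inv permutes_inv_o(1)[OF \<sigma>]] by blast
    show "\<forall>t\<in>?T (\<lambda>i. i). relabel \<sigma> (relabel (inv \<sigma>) t) = t"
      using relabel_relabel_inverse[OF inv \<sigma> permutes_inv_o(2)[OF \<sigma>]] by blast
    show "relabel \<sigma> ` ?T \<sigma> \<subseteq> ?T (\<lambda>i. i)"
      using full_relabel[OF \<sigma>] nodes_relabel[OF \<sigma>] edges_relabel[OF \<sigma>] by auto
    show "relabel (inv \<sigma>) ` ?T (\<lambda>i. i) \<subseteq> ?T \<sigma>"
      using full_relabel[OF inv] nodes_relabel[OF inv] edges_relabel[OF inv] \<sigma>_le
        permutes_inverses(2)[OF \<sigma>] by (auto simp: less_Suc_eq_le)
  qed
  then have "card (?T \<sigma>) = card (?T (\<lambda>i. i))"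
    by (rule bij_betw_same_card)
  then show ?thesis
    using card_dyck_paths_eq_card_trees[of k \<sigma>, OF \<sigma>_le]
      card_dyck_paths_eq_card_trees[of k "\<lambda>i. i"] by simp
qed

end
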